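(* Let $k \geq 1$ be an integer and let $G$ be a connected graph of order $n \geq 2$. Then $\gamma_{k}^t(G) \geq \frac{\mathrm{diam}(G)+1}{2k}$.
   Context: All graphs are finite and simple; $d_G(u,v)$ is the length of a shortest $(u,v)$-path in $G$, and for $S \subseteq V(G)$, $d_G(v,S)=\min_{w\in S} d_G(v,w)$. $\mathrm{diam}(G)$ is the maximum of $d_G(u,v)$ over all pairs of vertices. For an integer $k\ge 1$ and a graph $G$ without isolated vertices, a set $S\subseteq V(G)$ is a total $k$-dominating set of $G$ if $d_G(v, S\setminus\{v\}) \le k$ for every $v \in V(G)$; the total $k$-domination number $\gamma_k^t(G)$ is the minimum cardinality of such a set. *)

theory Defs
  imports "Graph_Theory.Graph_Theory" "HOL-Library.Extended_Nat"
begin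

text \<open>
  A finite simple graph is an instance of the locale \<^locale>\<open>graph\<close>: a finite, loop-free,
  symmetric digraph without parallel arcs, so that each edge is a pair of opposite arcs.
\<close>

text \<open>Distances are extended naturals: unreachable vertices, and the empty set, are at distance
  \<open>\<infinity>\<close>.\<close>

definition vdist :: "('a, 'b) pre_digraph \<Rightarrow> 'a \<Rightarrow> 'a \<Rightarrow> enat" where
  "vdist G u v = (INF p \<in> {p. pre_digraph.apath G u p v}. enat (length p))"

definition set_dist :: "('a, 'b) pre_digraph \<Rightarrow> 'a \<Rightarrow> 'a set \<Rightarrow> enat" where
  "set_dist G v S = (INF w \<in> S. vdist G v w)"

definition diam :: "('a, 'b) pre_digraph \<Rightarrow> enat" where
  "diam G = Max {vdist G u v | u v. u \<in> verts G \<and> v \<in> verts G}"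

definition total_k_dominating_set :: "('a, 'b) pre_digraph \<Rightarrow> nat \<Rightarrow> 'a set \<Rightarrow> bool" where
  "total_k_dominating_set G k S \<longleftrightarrow>
     S \<subseteq> verts G \<and> (\<forall>v \<in> verts G. set_dist G v (S - {v}) \<le> enat k)"

text \<open>Meaningful for \<open>k \<ge> 1\<close> and graphs without isolated vertices, where
  \<^term>\<open>verts G\<close> itself is a total \<open>k\<close>-dominating set; otherwise the minimum may range over
  the empty set.\<close>

definition total_k_domination_number :: "('a, 'b) pre_digraph \<Rightarrow> nat \<Rightarrow> nat" where
  "total_k_domination_number G k = Min (card ` {S. total_k_dominating_set G k S})"

text \<open>On connected graphs \<^term>\<open>diam\<close> is finite, so \<^term>\<open>the_enat\<close> applied to it is
  harmless; with at least two vertices and \<open>k \<ge> 1\<close> the minimum defining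
  \<^term>\<open>total_k_domination_number\<close> ranges over a nonempty finite set.\<close>

lemma vdist_le_length:
  "pre_digraph.apath G u p v \<Longrightarrow> vdist G u v \<le> enat (length p)"
  unfolding vdist_def by (rule INF_lower) simp

lemma connected_reachable:
  assumes "graph G" "Digraph_Component.connected G" "u \<in> verts G" "v \<in> verts G"
  shows "u \<rightarrow>\<^sup>*\<^bsub>G\<^esub> v"
proof -
  interpret graph G by fact
  have "u \<rightarrow>\<^sup>*\<^bsub>with_proj (mk_symmetric G)\<^esub> v"
    using assms(2-4) by (auto simp: Digraph_Component.connected_def strongly_connected_def)
  then show ?thesis
    using reachable_mk_symmetric_eq[OF sym_arcs] by simp
qed

lemma vdist_finite:
  assumes "graph G" "Digraph_Component.connected G" "u \<in> verts G" "v \<in> verts G"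
  shows "vdist G u v \<noteq> \<infinity>"
proof -
  interpret graph G by fact
  obtain p where "apath u p v"
    using connected_reachable[OF assms] reachable_apath by blast
  then have "vdist G u v \<le> enat (length p)" by (rule vdist_le_length)
  then show ?thesis by (cases "vdist G u v") auto
qed

lemma diam_finite:
  assumes "graph G" "Digraph_Component.connected G"
  shows "diam G \<noteq> \<infinity>"
proof -
  interpret graph G by fact
  let ?D = "{vdist G u v | u v. u \<in> verts G \<and> v \<in> verts G}"
  have "?D = (\<lambda>(u, v). vdist G u v) ` (verts G \<times> verts G)" by auto
  then have "finite ?D" by simp
  moreover have "?D \<noteq> {}"
    using assms(2) by (fastforce simp: Digraph_Component.connected_def strongly_connected_def)
  ultimately have "Max ?D \<in> ?D" by (rule Max_in)
  then show ?thesis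
    unfolding diam_def using vdist_finite[OF assms] by fastforce
qed

lemma finite_total_k_dominating_sets:
  "graph G \<Longrightarrow> finite {S. total_k_dominating_set G k S}"
proof -
  assume "graph G"
  then interpret graph G .
  have "{S. total_k_dominating_set G k S} \<subseteq> Pow (verts G)"
    by (auto simp: total_k_dominating_set_def)
  then show ?thesis by (rule finite_subset) simp
qed

lemma total_k_dominating_set_verts:
  assumes "k \<ge> 1" "graph G" "Digraph_Component.connected G" "card (verts G) \<ge> 2"
  shows "total_k_dominating_set G k (verts G)"
  unfolding total_k_dominating_set_def
proof (intro conjI ballI)
  interpret graph G by fact
  fix v assume v: "v \<in> verts G"
  have "\<not> verts G \<subseteq> {v}"
  proof
    assume "verts G \<subseteq> {v}"
    then have "card (verts G) \<le> card {v}" by (intro card_mono) auto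
    then show False using assms(4) by simp
  qed
  then obtain w where w: "w \<in> verts G" "w \<noteq> v" by auto
  obtain p where p: "apath v p w"
    using connected_reachable[OF assms(2,3) v w(1)] reachable_apath by blast
  then obtain e q where "p = e # q"
    using w(2) by (cases p) (auto simp: apath_Nil_iff)
  with p have e: "e \<in> arcs G" "tail G e = v" by (auto simp: apath_Cons_iff)
  have ne: "head G e \<noteq> v" using e no_loops[of e] by auto
  have "apath v [e] (head G e)"
    using e ne by (auto simp: apath_Cons_iff apath_Nil_iff)
  then have "vdist G v (head G e) \<le> enat 1" using vdist_le_length by fastforce
  moreover have "set_dist G v (verts G - {v}) \<le> vdist G v (head G e)"
    unfolding set_dist_def by (rule INF_lower) (use e ne in auto)
  ultimately show "set_dist G v (verts G - {v}) \<le> enat k"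
    using assms(1) by (meson enat_ord_simps(1) order_trans)
qed simp

end

theory Submission
  imports Defs
begin

text \<open>
  Sort the vertices by their distance \<open>f\<close> from one end of a diametral path; all levels
  \<open>0, \<dots>, diam G\<close> are nonempty and \<open>f\<close> is 1-Lipschitz. Pick a representative of each level, in
  the dominating set \<open>S\<close> whenever the level meets \<open>S\<close>. Each level is charged to an element of
  \<open>S\<close> at most \<open>k\<close> levels away that dominates its representative; if this dominator lies in
  another level, it is replaced by the representative of its own level. Then a representative is
  never charged by its own level, hence by at most \<open>2k\<close> levels, and any other element of \<open>S\<close> is
  charged by at most its own level.
\<close>

text \<open>In \<open>enat\<close>, being at most \<open>enat m\<close> means being strictly below
  \<open>enat (Suc m)\<close>, and a strict upper bound on an infimum is witnessed by a
  member.\<close>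

lemma INF_le_enat_iff: "(INF x \<in> A. f x) \<le> enat m \<longleftrightarrow> (\<exists>x \<in> A. f x \<le> enat m)"
proof -
  have *: "y \<le> enat m \<longleftrightarrow> y < enat (Suc m)" for y
    by (cases y) auto
  show ?thesis by (simp only: * INF_less_iff)
qed

lemma set_dist_le_iff: "set_dist G v S \<le> enat k \<longleftrightarrow> (\<exists>w \<in> S. vdist G v w \<le> enat k)"
  unfolding set_dist_def by (rule INF_le_enat_iff)

context wf_digraph
begin

text \<open>Passing from paths to walks makes concatenation, splitting and reversal available
  without any distinctness conditions.\<close>

lemma vdist_le_iff: "vdist G u v \<le> enat m \<longleftrightarrow> (\<exists>p. awalk u p v \<and> length p \<le> m)"
proof
  assume "vdist G u v \<le> enat m"
  then show "\<exists>p. awalk u p v \<and> length p \<le> m"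
    unfolding vdist_def INF_le_enat_iff by (auto intro: awalkI_apath)
next
  assume "\<exists>p. awalk u p v \<and> length p \<le> m"
  then obtain p where p: "awalk u p v" "length p \<le> m" by blast
  let ?q = "awalk_to_apath p"
  have q: "apath u ?q v" using p(1) by (rule apath_awalk_to_apath)
  then have "distinct ?q"
    unfolding apath_def using distinct_verts_imp_distinct by blast
  \<comment> \<open>The extracted path repeats no arc and uses only arcs of \<open>p\<close>, so
    counting arcs shows that it is no longer than \<open>p\<close>.\<close>
  then have "length ?q = card (set ?q)" by (simp add: distinct_card)
  also have "\<dots> \<le> card (set p)"
    using awalk_to_apath_subset[OF p(1)] by (simp add: card_mono)
  also have "\<dots> \<le> length p" by (rule card_length)
  finally have "enat (length ?q) \<le> enat m" using p(2) by simp
  with vdist_le_length[OF q] show "vdist G u v \<le> enat m" by (rule order_trans)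
qed

lemma vdist_triangle: "vdist G u w \<le> vdist G u v + vdist G v w"
proof (cases "vdist G u v + vdist G v w")
  case (enat n)
  then obtain a b where ab: "vdist G u v = enat a" "vdist G v w = enat b"
    by (cases "vdist G u v"; cases "vdist G v w") auto
  obtain p q where "awalk u p v" "length p \<le> a" "awalk v q w" "length q \<le> b"
    using ab vdist_le_iff by (metis order_refl)
  then have "awalk u (p @ q) w" "length (p @ q) \<le> a + b"
    by (auto intro: awalk_appendI simp del: awalk_append_iff)
  then have "vdist G u w \<le> enat (a + b)" unfolding vdist_le_iff by blast
  then show ?thesis using ab by simp
qed simp

text \<open>Cut a shortest walk after \<open>l\<close> arcs: were the cut vertex closer to
  \<open>u\<close> than \<open>l\<close>, the triangle inequality would bring \<open>v\<close>
  closer than \<open>d\<close>.\<close>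

lemma ex_vdist_eq:
  assumes "vdist G u v = enat d" "l \<le> d"
  shows "\<exists>w \<in> verts G. vdist G u w = enat l"
proof -
  obtain p where p: "awalk u p v" "length p \<le> d"
    using assms(1) vdist_le_iff by (metis order_refl)
  define w where "w = awlast u (take l p)"
  have "awalk u (take l p @ drop l p) v" using p(1) by simp
  then have w: "awalk u (take l p) w" "awalk w (drop l p) v"
    unfolding w_def awalk_append_iff by blast+
  have "length (take l p) \<le> l" "length (drop l p) \<le> d - l" using p(2) by simp_all
  then have le: "vdist G u w \<le> enat l" "vdist G w v \<le> enat (d - l)"
    using w vdist_le_iff by blast+
  then obtain a where a: "vdist G u w = enat a" by (cases "vdist G u w") auto
  have "enat d \<le> vdist G u w + vdist G w v"
    using vdist_triangle assms(1) by metis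
  also have "\<dots> \<le> enat a + enat (d - l)"
    unfolding a using le(2) by (rule add_left_mono)
  finally have "a = l" using a le(1) assms(2) by simp
  with a w(2) show ?thesis by blast
qed

end

text \<open>Each arc is replaced by an opposite arc, and the order is reversed.\<close>

lemma (in sym_digraph) ex_awalk_rev:
  "awalk u p v \<Longrightarrow> \<exists>q. awalk v q u \<and> length q = length p"
proof (induction p arbitrary: u)
  case Nil
  then show ?case by (auto simp: awalk_Nil_iff)
next
  case (Cons e p)
  then have e: "e \<in> arcs G" "tail G e = u" and "awalk (head G e) p v"
    by (auto simp: awalk_Cons_iff)
  then obtain q where q: "awalk v q (head G e)" "length q = length p"
    using Cons.IH by blast
  obtain e' where "e' \<in> arcs G" "tail G e' = head G e" "head G e' = u"
    using sym_arcs e unfolding symmetric_conv by metis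
  then have "awalk (head G e) [e'] u"
    using arc_implies_awalk by metis
  with q(1) have "awalk v (q @ [e']) u" by (rule awalk_appendI)
  with q(2) show ?case by (metis length_append_singleton length_Cons)
qed

lemma (in sym_digraph) vdist_sym_le: "vdist G u v \<le> enat m \<Longrightarrow> vdist G v u \<le> enat m"
  unfolding vdist_le_iff using ex_awalk_rev by metis

text \<open>The counting argument in isolation: the graph enters only through the level function
  \<open>f\<close>, and \<open>dom\<close> is what total domination leaves of it.\<close>

lemma levels_le_of_total_domination:
  fixes f :: "'a \<Rightarrow> nat"
  assumes k: "k \<ge> 1" and S: "finite S" "S \<subseteq> V"
    and level: "\<And>l. l \<le> d \<Longrightarrow> \<exists>v \<in> V. f v = l"
    and dom: "\<And>v. v \<in> V \<Longrightarrow> \<exists>w \<in> S - {v}. f w \<le> f v + k \<and> f v \<le> f w + k"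
  shows "d + 1 \<le> 2 * k * card S"
proof -
  define r where "r l = (if l \<in> f ` S then SOME v. v \<in> S \<and> f v = l else SOME v. v \<in> V \<and> f v = l)"
    for l
  have rS: "r l \<in> S \<and> f (r l) = l" if "l \<in> f ` S" for l
    using that someI_ex[of "\<lambda>v. v \<in> S \<and> f v = l"] by (auto simp: r_def)
  have rV: "r l \<in> V \<and> f (r l) = l" if "l \<le> d" for l
  proof (cases "l \<in> f ` S")
    case True
    then show ?thesis using rS S(2) by blast
  next
    case False
    then show ?thesis
      using level[OF that] someI_ex[of "\<lambda>v. v \<in> V \<and> f v = l"] by (auto simp: r_def)
  qed
  \<comment> \<open>The equivalence records the charging rule: a representative is charged only from
    other levels, any other element only from its own. If the dominator \<open>w\<close> of
    \<open>r l\<close> lies in level \<open>l\<close>, then \<open>w \<noteq> r l\<close> suffices;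
    otherwise \<open>r (f w)\<close> replaces it and is in \<open>S\<close> because its level meets
    \<open>S\<close>.\<close>
  have "\<exists>w \<in> S. f w \<le> l + k \<and> l \<le> f w + k \<and> (f w = l \<longleftrightarrow> w \<noteq> r (f w))"
    if l: "l \<le> d" for l
  proof -
    obtain w where w: "w \<in> S" "w \<noteq> r l" "f w \<le> l + k" "l \<le> f w + k"
      using dom[of "r l"] rV[OF l] by auto
    show ?thesis
    proof (cases "f w = l")
      case True
      then show ?thesis using w by blast
    next
      case False
      have "r (f w) \<in> S" "f (r (f w)) = f w" using rS[of "f w"] w(1) by auto
      then show ?thesis using False w(3,4) by (intro bexI[of _ "r (f w)"]) simp_all
    qed
  qed
  then obtain h where h: "\<And>l. l \<le> d \<Longrightarrow> h l \<in> S \<and> f (h l) \<le> l + k \<and> l \<le> f (h l) + k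
      \<and> (f (h l) = l \<longleftrightarrow> h l \<noteq> r (f (h l)))"
    by metis
  have fibre: "card {l. l \<le> d \<and> h l = w} \<le> 2 * k" for w
  proof (cases "w = r (f w)")
    case True
    \<comment> \<open>Leaving out the own level \<open>f w\<close> turns \<open>2 * k + 1\<close>
      into \<open>2 * k\<close>. Truncated subtraction can only shorten the lower interval.\<close>
    have "{l. l \<le> d \<and> h l = w} \<subseteq> {f w - k..<f w} \<union> {f w<..f w + k}"
    proof
      fix l assume "l \<in> {l. l \<le> d \<and> h l = w}"
      then have l: "l \<le> d" "h l = w" by simp_all
      have "f w \<le> l + k" "l \<le> f w + k" "f w \<noteq> l"
        using h[OF l(1)] True unfolding l(2) by metis+
      then show "l \<in> {f w - k..<f w} \<union> {f w<..f w + k}" by auto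
    qed
    then have "card {l. l \<le> d \<and> h l = w} \<le> card ({f w - k..<f w} \<union> {f w<..f w + k})"
      by (intro card_mono) auto
    also have "\<dots> \<le> card {f w - k..<f w} + card {f w<..f w + k}" by (rule card_Un_le)
    also have "\<dots> \<le> 2 * k" by simp
    finally show ?thesis .
  next
    case False
    have "l = f w" if "l \<le> d" "h l = w" for l
      using h[OF that(1)] False unfolding that(2) by metis
    then have "{l. l \<le> d \<and> h l = w} \<subseteq> {f w}" by blast
    then have "card {l. l \<le> d \<and> h l = w} \<le> card {f w}" by (intro card_mono) auto
    then show ?thesis using k by simp
  qed
  have "{..d} = (\<Union>w \<in> S. {l. l \<le> d \<and> h l = w})" using h by auto
  then have "d + 1 = card (\<Union>w \<in> S. {l. l \<le> d \<and> h l = w})"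
    by (metis card_atMost Suc_eq_plus1)
  also have "\<dots> \<le> (\<Sum>w \<in> S. card {l. l \<le> d \<and> h l = w})"
    using S(1) by (rule card_UN_le)
  also have "\<dots> \<le> card S * (2 * k)"
    using sum_bounded_above[of S _ "2 * k"] fibre by simp
  finally show ?thesis by (simp add: mult.commute)
qed

lemma total_k_dominating_set_card_ge:
  assumes k: "k \<ge> 1" and G: "graph G" "Digraph_Component.connected G"
    and S: "total_k_dominating_set G k S"
  shows "the_enat (diam G) + 1 \<le> 2 * k * card S"
proof -
  interpret graph G by fact
  let ?D = "{vdist G u v | u v. u \<in> verts G \<and> v \<in> verts G}"
  have "?D = (\<lambda>(u, v). vdist G u v) ` (verts G \<times> verts G)" by auto
  then have "finite ?D" by simp
  moreover have "?D \<noteq> {}"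
    using G(2) by (fastforce simp: Digraph_Component.connected_def strongly_connected_def)
  ultimately have "diam G \<in> ?D" unfolding diam_def by (rule Max_in)
  then obtain x y where xy: "x \<in> verts G" "y \<in> verts G" "diam G = vdist G x y" by blast
  then obtain d where d: "vdist G x y = enat d" using diam_finite[OF G] by auto
  \<comment> \<open>The levels are the distances from one end \<open>x\<close> of a pair realising
    the diameter.\<close>
  define f where "f v = the_enat (vdist G x v)" for v
  have f: "vdist G x v = enat (f v)" if "v \<in> verts G" for v
    using vdist_finite[OF G xy(1) that] unfolding f_def by auto
  have lip: "f w \<le> f v + k"
    if "v \<in> verts G" "w \<in> verts G" "vdist G v w \<le> enat k" for v w
  proof -
    have "enat (f w) \<le> enat (f v) + vdist G v w"
      using vdist_triangle[of x w v] f that(1,2) by simp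
    also have "\<dots> \<le> enat (f v) + enat k" using that(3) by (rule add_left_mono)
    finally show ?thesis by simp
  qed
  have SV: "S \<subseteq> verts G" using S by (simp add: total_k_dominating_set_def)
  have "d + 1 \<le> 2 * k * card S"
  proof (rule levels_le_of_total_domination[OF k _ SV])
    show "finite S" using SV by (rule finite_subset) simp
    show "\<exists>v \<in> verts G. f v = l" if "l \<le> d" for l
      using ex_vdist_eq[OF d that] unfolding f_def by (metis the_enat.simps)
    show "\<exists>w \<in> S - {v}. f w \<le> f v + k \<and> f v \<le> f w + k" if v: "v \<in> verts G" for v
    proof -
      obtain w where "w \<in> S - {v}" "vdist G v w \<le> enat k"
        using S v by (auto simp: total_k_dominating_set_def set_dist_le_iff)
      \<comment> \<open>The Lipschitz bound is applied in both directions, the second by symmetry of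
        the distance.\<close>
      then show ?thesis using lip vdist_sym_le v SV by blast
    qed
  qed
  then show ?thesis using xy(3) d by simp
qed

theorem theorem3p3:
  fixes G :: "('a, 'b) pre_digraph" and k :: nat
  assumes "k \<ge> 1"
    and "graph G"
    and "Digraph_Component.connected G"
    and "card (verts G) \<ge> 2"
  shows "real (total_k_domination_number G k) \<ge> (real (the_enat (diam G)) + 1) / (2 * real k)"
proof -
  let ?C = "card ` {S. total_k_dominating_set G k S}"
  have "finite ?C" using finite_total_k_dominating_sets[OF assms(2)] by simp
  moreover have "?C \<noteq> {}" using total_k_dominating_set_verts[OF assms] by blast
  \<comment> \<open>The minimum is attained, so the bound for every total
    \<open>k\<close>-dominating set applies to it.\<close>
  ultimately have "total_k_domination_number G k \<in> ?C"
    unfolding total_k_domination_number_def by (rule Min_in)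
  then have "the_enat (diam G) + 1 \<le> 2 * k * total_k_domination_number G k"
    using total_k_dominating_set_card_ge[OF assms(1-3)] by auto
  then have "real (the_enat (diam G) + 1) \<le> real (2 * k * total_k_domination_number G k)"
    by (simp only: of_nat_le_iff)
  then show ?thesis using assms(1) by (simp add: field_simps)
qed

end
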